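(* There are infinitely many (pairwise non-isomorphic) $4$-uniform Šoltés' hypergraphs.
   Context: A hypergraph $H=(V,E)$ consists of a finite vertex set $V$ and a set $E\subseteq 2^V$ of (hyper)edges, each edge being a set of at least two vertices. It is $4$-uniform if all its edges have exactly $4$ elements. For $v\in V$, $H\setminus v$ denotes the hypergraph with vertex set $V\setminus\{v\}$ whose edges are exactly the edges of $H$ that do not contain $v$. The distance $d(u,v)$ is the length $r$ of a shortest path $(v_0,e_1,v_1,\ldots,e_r,v_r)$ with $v_0=u$, $v_r=v$ and each $e_i$ an edge containing $v_{i-1}$ and $v_i$, no vertex or edge being repeated; it is infinite if there is no such path. $H$ is connected if all distances are finite. The total distance is $W(H)=\sum d(u,v)$, summed over all unordered pairs of distinct vertices. A Šoltés' hypergraph is a connected hypergraph $H$ such that $W(H\setminus v)$ is finite and $W(H)=W(H\setminus v)$ for every $v\in V$; by convention the one-vertex hypergraph $K_1$ is not a Šoltés' hypergraph, so a Šoltés' hypergraph has at least two vertices. *)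

theory Defs
  imports Main "HOL-Library.Extended_Nat"
begin

datatype 'a hypergraph = Hypergraph (verts: "'a set") (edges: "'a set set")

definition is_hypergraph :: "'a hypergraph \<Rightarrow> bool" where
  "is_hypergraph H \<longleftrightarrow>
     finite (verts H) \<and> edges H \<subseteq> Pow (verts H) \<and> (\<forall>e\<in>edges H. 2 \<le> card e)"

definition uniform :: "nat \<Rightarrow> 'a hypergraph \<Rightarrow> bool" where
  "uniform k H \<longleftrightarrow> (\<forall>e\<in>edges H. card e = k)"

definition delete_vertex :: "'a hypergraph \<Rightarrow> 'a \<Rightarrow> 'a hypergraph" where
  "delete_vertex H v = Hypergraph (verts H - {v}) {e \<in> edges H. v \<notin> e}"

(* The path (v_0, e_1, v_1, ..., e_r, v_r) is split into vs = [v_0, ..., v_r] and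
   es = [e_1, ..., e_r]; its length r is the length of es. *)
definition is_path :: "'a hypergraph \<Rightarrow> 'a \<Rightarrow> 'a \<Rightarrow> 'a list \<Rightarrow> 'a set list \<Rightarrow> bool" where
  "is_path H u v vs es \<longleftrightarrow>
     length vs = length es + 1 \<and> hd vs = u \<and> last vs = v \<and>
     set vs \<subseteq> verts H \<and> set es \<subseteq> edges H \<and> distinct vs \<and> distinct es \<and>
     (\<forall>i<length es. vs ! i \<in> es ! i \<and> vs ! Suc i \<in> es ! i)"

(* The infimum over the empty set is \<infinity> in enat. *)
definition distance :: "'a hypergraph \<Rightarrow> 'a \<Rightarrow> 'a \<Rightarrow> enat" where
  "distance H u v = Inf {enat (length es) |vs es. is_path H u v vs es}"

definition connected_hypergraph :: "'a hypergraph \<Rightarrow> bool" where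
  "connected_hypergraph H \<longleftrightarrow> (\<forall>u\<in>verts H. \<forall>v\<in>verts H. distance H u v \<noteq> \<infinity>)"

(* Distance of an unordered pair; well defined by symmetry of distance, see
   pair_distance_eq below. *)
definition pair_distance :: "'a hypergraph \<Rightarrow> 'a set \<Rightarrow> enat" where
  "pair_distance H P = (THE d. \<exists>u v. P = {u, v} \<and> d = distance H u v)"

definition total_distance :: "'a hypergraph \<Rightarrow> enat" where
  "total_distance H = (\<Sum>P | P \<subseteq> verts H \<and> card P = 2. pair_distance H P)"

definition soltes_hypergraph :: "'a hypergraph \<Rightarrow> bool" where
  "soltes_hypergraph H \<longleftrightarrow>
     is_hypergraph H \<and> 2 \<le> card (verts H) \<and> connected_hypergraph H \<and>
     (\<forall>v\<in>verts H. total_distance (delete_vertex H v) \<noteq> \<infinity> \<and>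
        total_distance H = total_distance (delete_vertex H v))"

definition isomorphic :: "'a hypergraph \<Rightarrow> 'b hypergraph \<Rightarrow> bool" where
  "isomorphic G H \<longleftrightarrow>
     (\<exists>f. bij_betw f (verts G) (verts H) \<and> (\<lambda>e. f ` e) ` edges G = edges H)"

lemma is_path_rev:
  assumes "is_path H u v vs es"
  shows "is_path H v u (rev vs) (rev es)"
proof -
  have len: "length vs = length es + 1" using assms by (simp add: is_path_def)
  have adj: "\<And>i. i < length es \<Longrightarrow> vs ! i \<in> es ! i \<and> vs ! Suc i \<in> es ! i"
    using assms by (simp add: is_path_def)
  have "rev vs ! i \<in> rev es ! i \<and> rev vs ! Suc i \<in> rev es ! i" if i: "i < length es" for i
  proof -
    define j where "j = length es - Suc i"
    have j: "j < length es" "rev es ! i = es ! j" "rev vs ! i = vs ! Suc j"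
      "rev vs ! Suc i = vs ! j"
      using i len by (auto simp: j_def rev_nth Suc_diff_Suc)
    then show ?thesis using adj[OF j(1)] by simp
  qed
  then show ?thesis
    using assms len by (auto simp: is_path_def hd_rev last_rev)
qed

lemma distance_commute: "distance H u v = distance H v u"
proof -
  have "{enat (length es) |vs es. is_path H a b vs es} \<subseteq>
        {enat (length es) |vs es. is_path H b a vs es}" for a b
  proof
    fix d assume "d \<in> {enat (length es) |vs es. is_path H a b vs es}"
    then obtain vs es where "is_path H b a (rev vs) (rev es)" "d = enat (length (rev es))"
      using is_path_rev by fastforce
    then show "d \<in> {enat (length es) |vs es. is_path H b a vs es}" by blast
  qed
  from subset_antisym[OF this this] show ?thesis
    unfolding distance_def by (rule arg_cong)
qed

lemma pair_distance_eq: "pair_distance H {u, v} = distance H u v"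
  unfolding pair_distance_def
proof (rule the_equality)
  show "\<exists>a b. {u, v} = {a, b} \<and> distance H u v = distance H a b" by blast
next
  fix d assume "\<exists>a b. {u, v} = {a, b} \<and> d = distance H a b"
  then show "d = distance H u v"
    using distance_commute[of H u v] by (auto simp: doubleton_eq_iff)
qed

end

theory Submission imports Defs
begin

text \<open>
  The examples are Steiner systems S(2,4,\<open>n\<close>) with \<open>n > 4\<close>: any two vertices lie in exactly one
  common edge, and every edge has four vertices.  All distances are 1, so the total distance is
  the number of pairs of vertices.  Deleting \<open>v\<close> loses the \<open>n - 1\<close> pairs that contain \<open>v\<close>, hence
  a total of \<open>n - 1\<close>.  It also destroys the edges through \<open>v\<close>; these partition the other vertices
  into triples, and precisely the pairs inside a triple lose their only edge.  Such a pair gets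
  distance 2, by a detour through any vertex outside the destroyed edge.  A triple has as many
  pairs as it has points, so the number of these pairs is again \<open>n - 1\<close>, and gain and loss cancel
  (\<open>steiner_soltes\<close>).  This balance is special to edges of size 4.

  Infinitely many such systems are given by the points and lines of the affine spaces
  AG(\<open>m\<close>,4) with \<open>m \<ge> 2\<close> (\<open>affine_space_steiner\<close>).  They are told apart by their numbers
  of points, \<open>4 ^ m\<close>.
\<close>

section \<open>Distances one and two\<close>

lemma distance_le_path: "is_path H u v vs es \<Longrightarrow> distance H u v \<le> enat (length es)"
  unfolding distance_def by (rule Inf_lower) blast

lemma path_nonempty:
  assumes "is_path H u v vs es" "u \<noteq> v"
  shows "es \<noteq> []"
  using assms by (auto simp: is_path_def length_Suc_conv)

lemma path_single_edge:
  assumes "is_path H u v vs [e]"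
  shows "e \<in> edges H" "u \<in> e" "v \<in> e"
  using assms by (auto simp: is_path_def length_Suc_conv)

lemma distance_refl:
  assumes "u \<in> verts H"
  shows "distance H u u = 0"
proof -
  have "is_path H u u [u] []"
    using assms by (simp add: is_path_def)
  from distance_le_path[OF this] show ?thesis by (simp add: zero_enat_def[symmetric])
qed

lemma distance_eq_1:
  assumes "u \<noteq> v" "u \<in> verts H" "v \<in> verts H" "e \<in> edges H" "u \<in> e" "v \<in> e"
  shows "distance H u v = 1"
proof (rule antisym)
  have "is_path H u v [u, v] [e]"
    using assms by (simp add: is_path_def)
  from distance_le_path[OF this] show "distance H u v \<le> 1" by (simp add: one_enat_def)
next
  have "1 \<le> length es" if "is_path H u v vs es" for vs es
    using path_nonempty[OF that \<open>u \<noteq> v\<close>] by (cases es) auto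
  then show "1 \<le> distance H u v"
    unfolding distance_def by (intro Inf_greatest) (auto simp: one_enat_def)
qed

lemma distance_eq_2:
  assumes "u \<noteq> v" "u \<in> verts H" "v \<in> verts H" "w \<in> verts H"
    and no_edge: "\<And>e. e \<in> edges H \<Longrightarrow> u \<in> e \<Longrightarrow> v \<notin> e"
    and "e \<in> edges H" "u \<in> e" "w \<in> e" "f \<in> edges H" "w \<in> f" "v \<in> f"
  shows "distance H u v = 2"
proof (rule antisym)
  have "w \<noteq> u" "w \<noteq> v" "e \<noteq> f" using assms by auto
  then have "is_path H u v [u, w, v] [e, f]"
    using assms by (auto simp: is_path_def less_Suc_eq)
  from distance_le_path[OF this] show "distance H u v \<le> 2"
    by (simp add: numeral_eq_enat numeral_2_eq_2)
next
  have "2 \<le> length es" if p: "is_path H u v vs es" for vs es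
  proof -
    have "es \<noteq> []" using path_nonempty[OF p \<open>u \<noteq> v\<close>] .
    moreover have "es \<noteq> [e]" for e using path_single_edge p no_edge by metis
    ultimately show ?thesis by (cases es rule: remdups_adj.cases) auto
  qed
  then show "2 \<le> distance H u v"
    unfolding distance_def by (intro Inf_greatest) (auto simp: numeral_eq_enat)
qed

lemma total_distance_eqI:
  assumes "\<And>u v. u \<in> verts H \<Longrightarrow> v \<in> verts H \<Longrightarrow> u \<noteq> v \<Longrightarrow> distance H u v = d {u, v}"
  shows "total_distance H = (\<Sum>P | P \<subseteq> verts H \<and> card P = 2. d P)"
  unfolding total_distance_def
  by (rule sum.cong) (use assms in \<open>auto simp: card_2_iff pair_distance_eq\<close>)

section \<open>Steiner systems\<close>

text \<open>
  The systems S(2,4,\<open>n\<close>), where \<open>n\<close> is the number of vertices.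
\<close>

definition steiner_system :: "'a hypergraph \<Rightarrow> bool" where
  "steiner_system H \<longleftrightarrow> is_hypergraph H \<and> uniform 4 H \<and>
     (\<forall>u\<in>verts H. \<forall>v\<in>verts H. u \<noteq> v \<longrightarrow> (\<exists>!e. e \<in> edges H \<and> u \<in> e \<and> v \<in> e))"

lemma
  assumes "steiner_system H"
  shows steiner_finite: "finite (verts H)"
    and steiner_edge_subset: "e \<in> edges H \<Longrightarrow> e \<subseteq> verts H"
    and steiner_card_edge: "e \<in> edges H \<Longrightarrow> card e = 4"
  using assms by (auto simp: steiner_system_def is_hypergraph_def uniform_def)

lemma steiner_edge_exists:
  assumes "steiner_system H" "u \<in> verts H" "v \<in> verts H" "u \<noteq> v"
  obtains e where "e \<in> edges H" "u \<in> e" "v \<in> e"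
  using assms unfolding steiner_system_def by blast

lemma steiner_edge_unique:
  assumes "steiner_system H" "e \<in> edges H" "f \<in> edges H"
    and "u \<in> e" "v \<in> e" "u \<in> f" "v \<in> f" "u \<noteq> v"
  shows "e = f"
proof -
  have "u \<in> verts H" "v \<in> verts H" using assms steiner_edge_subset by fast+
  then show ?thesis using assms unfolding steiner_system_def by blast
qed

lemma steiner_distance:
  assumes "steiner_system H" "u \<in> verts H" "v \<in> verts H" "u \<noteq> v"
  shows "distance H u v = 1"
  using assms steiner_edge_exists[OF assms] distance_eq_1 by metis

text \<open>
  In a Steiner system, the pairs whose only common edge disappears with \<open>v\<close>.
\<close>

definition split_pairs :: "'a hypergraph \<Rightarrow> 'a \<Rightarrow> 'a set set" where
  "split_pairs H v = {P. card P = 2 \<and> v \<notin> P \<and> (\<exists>e\<in>edges H. insert v P \<subseteq> e)}"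

text \<open>
  An edge through \<open>v\<close> has three further vertices, and taking complements within these three matches
  them with their pairs: \<open>w\<close> corresponds to \<open>e - {v, w}\<close>, where \<open>e\<close> is the edge through
  \<open>v\<close> and \<open>w\<close>.
\<close>

lemma card_split_pairs:
  assumes H: "steiner_system H" and v: "v \<in> verts H"
  shows "card (split_pairs H v) = card (verts H - {v})"
proof -
  define opp where "opp w = (THE e. e \<in> edges H \<and> v \<in> e \<and> w \<in> e) - {v, w}" for w
  have opp: "opp w = e - {v, w}" if "e \<in> edges H" "v \<in> e" "w \<in> e" "w \<noteq> v" for e w
  proof -
    have "(THE e. e \<in> edges H \<and> v \<in> e \<and> w \<in> e) = e"
      using that steiner_edge_unique[OF H] by (intro the_equality) blast+
    then show ?thesis by (simp add: opp_def)
  qed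
  have edge: "\<exists>e\<in>edges H. v \<in> e \<and> w \<in> e" if "w \<in> verts H - {v}" for w
    using steiner_edge_exists[OF H v] that by (metis DiffE singletonI)
  have fin: "finite e" if "e \<in> edges H" for e
    using steiner_finite[OF H] steiner_edge_subset[OF H that] by (rule finite_subset[rotated])
  have card_opp: "card (e - {v, w}) = 2" if "e \<in> edges H" "v \<in> e" "w \<in> e" "w \<noteq> v" for e w
    using that fin steiner_card_edge[OF H] by (simp add: card_Diff_subset)
  have "bij_betw opp (verts H - {v}) (split_pairs H v)"
    unfolding bij_betw_def
  proof
    show "inj_on opp (verts H - {v})"
    proof (rule inj_onI)
      fix w x assume w: "w \<in> verts H - {v}" and x: "x \<in> verts H - {v}" and eq: "opp w = opp x"
      obtain e f where e: "e \<in> edges H" "v \<in> e" "w \<in> e" and f: "f \<in> edges H" "v \<in> f" "x \<in> f"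
        using edge w x by blast
      have oe: "opp w = e - {v, w}" and of': "opp x = f - {v, x}"
        using opp e f w x by blast+
      have "card (opp w) = 2" unfolding oe by (rule card_opp) (use e w in \<open>auto\<close>)
      then obtain y where "y \<in> opp w" by (cases "opp w = {}") auto
      then have "y \<in> e" "y \<in> f" "y \<noteq> v" using oe of' eq by auto
      then have "e = f" using steiner_edge_unique[OF H] e f by blast
      then show "w = x" using oe of' eq e f w x by auto
    qed
    show "opp ` (verts H - {v}) = split_pairs H v"
    proof (intro equalityI subsetI)
      fix P assume "P \<in> opp ` (verts H - {v})"
      then obtain w where w: "w \<in> verts H - {v}" "P = opp w" by blast
      obtain e where e: "e \<in> edges H" "v \<in> e" "w \<in> e" using edge w by blast
      then have "P = e - {v, w}" using opp w by blast
      then show "P \<in> split_pairs H v"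
        using e w card_opp unfolding split_pairs_def by blast
    next
      fix P assume "P \<in> split_pairs H v"
      then obtain e where P: "card P = 2" "v \<notin> P" and e: "e \<in> edges H" "insert v P \<subseteq> e"
        unfolding split_pairs_def by blast
      have "finite P" using P by (metis card.infinite zero_neq_numeral)
      then have "card (e - insert v P) = 1"
        using P e fin steiner_card_edge[OF H] by (simp add: card_Diff_subset)
      then obtain w where w: "e - insert v P = {w}" by (auto simp: card_1_singleton_iff)
      then have "opp w = e - {v, w}" using e by (intro opp) auto
      also have "\<dots> = P" using w e P by blast
      finally have "P = opp w" by simp
      moreover have "w \<in> verts H - {v}" using w e steiner_edge_subset[OF H] by blast
      ultimately show "P \<in> opp ` (verts H - {v})" by blast
    qed
  qed
  then show ?thesis by (simp add: bij_betw_same_card)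
qed

text \<open>
  A pair \<open>x\<close>, \<open>y\<close> whose edge \<open>e\<close> contains \<open>v\<close> is still joined through any vertex \<open>z\<close> outside
  \<open>e\<close>: an edge that contains \<open>z\<close> and meets \<open>e\<close> in \<open>x\<close> or \<open>y\<close> avoids \<open>v\<close>, since otherwise it
  would share two vertices with \<open>e\<close> and equal it.
\<close>

lemma steiner_distance_delete_vertex:
  assumes H: "steiner_system H" and large: "4 < card (verts H)" and v: "v \<in> verts H"
    and x: "x \<in> verts H - {v}" and y: "y \<in> verts H - {v}" and "x \<noteq> y"
  shows "distance (delete_vertex H v) x y = (if {x, y} \<in> split_pairs H v then 2 else 1)"
proof -
  have xy: "x \<in> verts (delete_vertex H v)" "y \<in> verts (delete_vertex H v)"
    using x y by (simp_all add: delete_vertex_def)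
  obtain e where e: "e \<in> edges H" "x \<in> e" "y \<in> e"
    using steiner_edge_exists[OF H] x y \<open>x \<noteq> y\<close> by (metis DiffE)
  have only_e: "f = e" if "f \<in> edges H" "x \<in> f" "y \<in> f" for f
    using steiner_edge_unique[OF H that(1) e(1) that(2,3) e(2,3) \<open>x \<noteq> y\<close>] .
  have "card {x, y} = 2" "v \<notin> {x, y}" using x y \<open>x \<noteq> y\<close> by auto
  then have split: "{x, y} \<in> split_pairs H v \<longleftrightarrow> v \<in> e"
    using e only_e unfolding split_pairs_def by blast
  show ?thesis
  proof (cases "v \<in> e")
    case False
    then have "e \<in> edges (delete_vertex H v)" using e by (simp add: delete_vertex_def)
    from distance_eq_1[OF \<open>x \<noteq> y\<close> xy this e(2,3)] show ?thesis using split False by simp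
  next
    case True
    have "\<not> verts H \<subseteq> e"
      using large steiner_card_edge[OF H e(1)] steiner_finite[OF H]
      by (metis card_mono card.infinite leD zero_neq_numeral)
    then obtain z where z: "z \<in> verts H" "z \<notin> e" by blast
    have detour: "\<exists>f\<in>edges H. u \<in> f \<and> z \<in> f \<and> v \<notin> f" if u: "u \<in> e" "u \<noteq> v" for u
    proof -
      have "u \<in> verts H" "u \<noteq> z" using u z e steiner_edge_subset[OF H] by blast+
      then obtain f where f: "f \<in> edges H" "u \<in> f" "z \<in> f"
        using steiner_edge_exists[OF H] z by metis
      moreover have "v \<notin> f"
        using steiner_edge_unique[OF H f(1) e(1) f(2) _ u(1) True u(2)] f z by blast
      ultimately show ?thesis by blast
    qed
    have "x \<noteq> v" "y \<noteq> v" using x y by simp_all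
    obtain f where f: "f \<in> edges H" "x \<in> f" "z \<in> f" "v \<notin> f"
      using detour[OF e(2) \<open>x \<noteq> v\<close>] by blast
    obtain g where g: "g \<in> edges H" "y \<in> g" "z \<in> g" "v \<notin> g"
      using detour[OF e(3) \<open>y \<noteq> v\<close>] by blast
    have no_edge: "y \<notin> h" if "h \<in> edges (delete_vertex H v)" "x \<in> h" for h
      using that only_e True by (auto simp: delete_vertex_def)
    have z': "z \<in> verts (delete_vertex H v)" and f': "f \<in> edges (delete_vertex H v)"
      and g': "g \<in> edges (delete_vertex H v)"
      using f g z True by (auto simp: delete_vertex_def)
    have "distance (delete_vertex H v) x y = 2"
      using distance_eq_2[OF \<open>x \<noteq> y\<close> xy z' no_edge f' f(2,3) g' g(3,2)] by simp
    then show ?thesis using split True by simp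
  qed
qed

lemma steiner_total_distance_delete_vertex:
  assumes H: "steiner_system H" and large: "4 < card (verts H)" and v: "v \<in> verts H"
  shows "total_distance (delete_vertex H v) = enat (card (verts H) choose 2)"
proof -
  let ?n = "card (verts H)"
  let ?A = "{P. P \<subseteq> verts H - {v} \<and> card P = 2}"
  have fin: "finite (verts H)" by (rule steiner_finite[OF H])
  then have finA: "finite ?A" by simp
  have n: "card (verts H - {v}) = ?n - 1" using v fin by simp
  have "split_pairs H v \<subseteq> ?A"
    using steiner_edge_subset[OF H] by (auto simp: split_pairs_def)
  then have inter: "?A \<inter> split_pairs H v = split_pairs H v" by blast
  have "total_distance (delete_vertex H v) =
      (\<Sum>P | P \<subseteq> verts (delete_vertex H v) \<and> card P = 2. if P \<in> split_pairs H v then 2 else 1)"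
    by (rule total_distance_eqI, rule steiner_distance_delete_vertex[OF H large v])
      (auto simp: delete_vertex_def)
  also have "\<dots> = (\<Sum>P\<in>?A. enat (1 + (if P \<in> split_pairs H v then 1 else 0)))"
    by (intro sum.cong) (auto simp: delete_vertex_def one_enat_def numeral_eq_enat)
  also have "\<dots> = of_nat (\<Sum>P\<in>?A. 1 + (if P \<in> split_pairs H v then 1 else 0))"
    by (simp only: of_nat_sum of_nat_eq_enat[symmetric])
  also have "(\<Sum>P\<in>?A. 1 + (if P \<in> split_pairs H v then 1 else 0)) = card ?A + card (split_pairs H v)"
    using finA inter by (simp only: sum.distrib sum.inter_restrict[symmetric]) simp
  also have "\<dots> = ((?n - 1) choose 2) + (?n - 1)"
    using n_subsets[of "verts H - {v}" 2] card_split_pairs[OF H v] fin n by simp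
  also have "\<dots> = ?n choose 2"
    using large by (cases ?n) (simp_all add: numeral_2_eq_2)
  finally show ?thesis by (simp add: of_nat_eq_enat)
qed

theorem steiner_soltes:
  assumes H: "steiner_system H" and large: "4 < card (verts H)"
  shows "soltes_hypergraph H"
proof -
  have "total_distance H = (\<Sum>P | P \<subseteq> verts H \<and> card P = 2. 1)"
    by (rule total_distance_eqI) (rule steiner_distance[OF H])
  also have "\<dots> = enat (card (verts H) choose 2)"
    using n_subsets[of "verts H" 2] steiner_finite[OF H] by (simp add: of_nat_eq_enat)
  finally have total: "total_distance H = enat (card (verts H) choose 2)" .
  have "distance H u v \<noteq> \<infinity>" if "u \<in> verts H" "v \<in> verts H" for u v
    using steiner_distance[OF H that] distance_refl[of u H] that by (cases "u = v") auto
  then show ?thesis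
    using H large total steiner_total_distance_delete_vertex[OF H large]
    by (simp add: soltes_hypergraph_def connected_hypergraph_def steiner_system_def)
qed

section \<open>Affine spaces over the field with four elements\<close>

text \<open>
  With the digits 0, 1, 2, 3 standing for \<open>0\<close>, \<open>1\<close>, \<open>\<omega>\<close>, \<open>\<omega>\<^sup>2\<close> in the field with four elements,
  where \<open>\<omega>\<^sup>2 = \<omega> + 1\<close>, this is the table of \<open>x \<cdot> y = x + \<omega> (y - x) = \<omega>\<^sup>2 x + \<omega> y\<close>.
\<close>

definition digit_op :: "nat \<Rightarrow> nat \<Rightarrow> nat" where
  "digit_op x y = [[0, 2, 3, 1], [3, 1, 0, 2], [1, 3, 2, 0], [2, 0, 1, 3]] ! x ! y"

lemma less_4_cases: "(x::nat) < 4 \<longleftrightarrow> x = 0 \<or> x = 1 \<or> x = 2 \<or> x = 3"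
  by auto

lemma digit_op_idem: "x < 4 \<Longrightarrow> digit_op x x = x"
  unfolding less_4_cases by (elim disjE; simp add: digit_op_def)

text \<open>
  Apart from closure, the laws are identities between linear combinations of \<open>x\<close> and \<open>y\<close>; for
  instance \<open>(x \<cdot> y) \<cdot> x = y\<close> holds because \<open>\<omega>\<^sup>2 \<omega>\<^sup>2 + \<omega> = 0\<close> and \<open>\<omega>\<^sup>2 \<omega> = 1\<close>.  They make explicit
  how any two points of the line through \<open>x\<close> and \<open>y\<close> produce the other two.
\<close>

lemma digit_op_laws:
  assumes "x < 4" "y < 4"
  shows "digit_op x y < 4"
    and "digit_op (digit_op x y) x = y"
    and "digit_op (digit_op x y) y = digit_op y x"
    and "digit_op x (digit_op x y) = digit_op y x"
    and "digit_op x (digit_op y x) = y"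
    and "digit_op (digit_op x y) (digit_op y x) = x"
  using assms unfolding less_4_cases by (elim disjE; simp add: digit_op_def)+

text \<open>
  A number below \<open>4 ^ m\<close> encodes the vector of its \<open>m\<close> base-4 digits, on which \<open>digit_op\<close> acts
  coordinatewise.  The laws of the field thus carry over to every dimension.
\<close>

fun affine_op :: "nat \<Rightarrow> nat \<Rightarrow> nat \<Rightarrow> nat" where
  "affine_op 0 x y = 0"
| "affine_op (Suc m) x y = 4 * affine_op m (x div 4) (y div 4) + digit_op (x mod 4) (y mod 4)"

lemma affine_op_less: "affine_op m x y < 4 ^ m"
proof (induction m arbitrary: x y)
  case (Suc m)
  have "digit_op (x mod 4) (y mod 4) < 4" by (simp add: digit_op_laws)
  with Suc[of "x div 4" "y div 4"] show ?case by simp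
qed simp

lemma affine_op_div_mod:
  "affine_op (Suc m) x y div 4 = affine_op m (x div 4) (y div 4)"
  "affine_op (Suc m) x y mod 4 = digit_op (x mod 4) (y mod 4)"
  using digit_op_laws(1)[of "x mod 4" "y mod 4"] by simp_all

lemma eq_nat_by_digit: "x div 4 = y div 4 \<Longrightarrow> x mod 4 = y mod 4 \<Longrightarrow> x = (y::nat)"
  by (metis mult_div_mod_eq)

lemma less_4_power_Suc_div: "x < 4 ^ Suc m \<Longrightarrow> x div 4 < (4::nat) ^ m"
  by (simp add: less_mult_imp_div_less)

lemma affine_op_laws:
  assumes "x < 4 ^ m" "y < 4 ^ m"
  shows "affine_op m x x = x"
    and "affine_op m (affine_op m x y) x = y"
    and "affine_op m (affine_op m x y) y = affine_op m y x"
    and "affine_op m x (affine_op m x y) = affine_op m y x"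
    and "affine_op m x (affine_op m y x) = y"
    and "affine_op m (affine_op m x y) (affine_op m y x) = x"
proof -
  have "affine_op m x x = x \<and> affine_op m (affine_op m x y) x = y \<and>
      affine_op m (affine_op m x y) y = affine_op m y x \<and>
      affine_op m x (affine_op m x y) = affine_op m y x \<and>
      affine_op m x (affine_op m y x) = y \<and>
      affine_op m (affine_op m x y) (affine_op m y x) = x"
    using assms
  proof (induction m arbitrary: x y)
    case (Suc m)
    note IH = Suc.IH[OF Suc.prems[THEN less_4_power_Suc_div]]
    show ?case
      by (intro conjI; rule eq_nat_by_digit)
        (simp_all add: affine_op_div_mod IH digit_op_idem digit_op_laws del: affine_op.simps)
  qed simp
  then show "affine_op m x x = x"
    and "affine_op m (affine_op m x y) x = y"
    and "affine_op m (affine_op m x y) y = affine_op m y x"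
    and "affine_op m x (affine_op m x y) = affine_op m y x"
    and "affine_op m x (affine_op m y x) = y"
    and "affine_op m (affine_op m x y) (affine_op m y x) = x"
    by blast+
qed

text \<open>
  The points \<open>x + t (y - x)\<close> for \<open>t = 0, 1, \<omega>, \<omega>\<^sup>2\<close>; the last one is \<open>affine_op m y x\<close> because
  \<open>1 - \<omega>\<^sup>2 = \<omega>\<close>.
\<close>

definition affine_line :: "nat \<Rightarrow> nat \<Rightarrow> nat \<Rightarrow> nat set" where
  "affine_line m x y = {x, y, affine_op m x y, affine_op m y x}"

lemma card_affine_line:
  assumes "x < 4 ^ m" "y < 4 ^ m" "x \<noteq> y"
  shows "card (affine_line m x y) = 4"
proof -
  note laws = affine_op_laws[OF assms(1,2)] affine_op_laws[OF assms(2,1)]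
  have "affine_op m x y \<noteq> x" "affine_op m y x \<noteq> y"
    using laws(1,2,7,8) assms(3) by metis+
  moreover from this have "affine_op m x y \<noteq> y" "affine_op m y x \<noteq> x"
    using laws(1,3,7,9) by metis+
  moreover have "affine_op m x y \<noteq> affine_op m y x"
  proof
    assume "affine_op m x y = affine_op m y x"
    then have "affine_op m x y = x"
      using laws(6) affine_op_laws(1)[OF affine_op_less affine_op_less] by simp
    with \<open>affine_op m x y \<noteq> x\<close> show False by simp
  qed
  ultimately show ?thesis using assms(3) by (auto simp: affine_line_def)
qed

text \<open>
  This gives uniqueness of the edge through two vertices: a line that contains \<open>u\<close> and \<open>v\<close> is
  the line spanned by them.
\<close>

lemma affine_line_eq:
  assumes "x < 4 ^ m" "y < 4 ^ m" "u \<in> affine_line m x y" "v \<in> affine_line m x y" "u \<noteq> v"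
  shows "affine_line m u v = affine_line m x y"
proof -
  let ?L = "affine_line m x y"
  note laws = affine_op_laws[OF assms(1,2)] affine_op_laws[OF assms(2,1)]
  have "\<forall>u\<in>?L. \<forall>v\<in>?L. u \<noteq> v \<longrightarrow> affine_line m u v = ?L"
    by (simp add: affine_line_def laws insert_commute)
  then show ?thesis using assms(3-5) by blast
qed

definition affine_space :: "nat \<Rightarrow> nat hypergraph" where
  "affine_space m = Hypergraph {..<4 ^ m} {affine_line m x y |x y. x < 4 ^ m \<and> y < 4 ^ m \<and> x \<noteq> y}"

lemma affine_space_steiner: "steiner_system (affine_space m)"
  unfolding steiner_system_def
proof (intro conjI ballI impI)
  have "affine_line m x y \<subseteq> {..<4 ^ m}" if "x < 4 ^ m" "y < 4 ^ m" for x y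
    using that by (simp add: affine_line_def affine_op_less)
  then show "is_hypergraph (affine_space m)"
    by (auto simp: is_hypergraph_def affine_space_def card_affine_line)
  show "uniform 4 (affine_space m)"
    by (auto simp: uniform_def affine_space_def card_affine_line)
next
  fix u v assume uv: "u \<in> verts (affine_space m)" "v \<in> verts (affine_space m)" "u \<noteq> v"
  show "\<exists>!e. e \<in> edges (affine_space m) \<and> u \<in> e \<and> v \<in> e"
  proof (rule ex1I[of _ "affine_line m u v"])
    show "affine_line m u v \<in> edges (affine_space m) \<and> u \<in> affine_line m u v \<and> v \<in> affine_line m u v"
      using uv by (auto simp: affine_space_def affine_line_def)
  next
    fix e assume e: "e \<in> edges (affine_space m) \<and> u \<in> e \<and> v \<in> e"
    then obtain x y where xy: "x < 4 ^ m" "y < 4 ^ m" "e = affine_line m x y"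
      by (auto simp: affine_space_def)
    have "u \<in> affine_line m x y" "v \<in> affine_line m x y" using e xy(3) by simp_all
    from affine_line_eq[OF xy(1,2) this uv(3)] show "e = affine_line m u v" using xy(3) by simp
  qed
qed

lemma isomorphic_card_verts: "isomorphic G H \<Longrightarrow> card (verts G) = card (verts H)"
  by (auto simp: isomorphic_def dest: bij_betw_same_card)

theorem proposition5:
  "\<exists>S :: nat hypergraph set. infinite S \<and>
     (\<forall>H\<in>S. uniform 4 H \<and> soltes_hypergraph H) \<and>
     pairwise (\<lambda>G H. \<not> isomorphic G H) S"
proof (intro exI conjI)
  \<comment> \<open>Dimensions 0 and 1 give a point and a single line, which have no vertex for a detour.\<close>
  let ?S = "range (\<lambda>m. affine_space (m + 2))"
  have card: "card (verts (affine_space m)) = 4 ^ m" for m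
    by (simp add: affine_space_def)
  have "inj (\<lambda>m. affine_space (m + 2))"
  proof (rule injI)
    fix m n assume "affine_space (m + 2) = affine_space (n + 2)"
    then have "(4::nat) ^ (m + 2) = 4 ^ (n + 2)" using card by metis
    then show "m = n" by simp
  qed
  then show "infinite ?S" by (rule range_inj_infinite)
  show "\<forall>H\<in>?S. uniform 4 H \<and> soltes_hypergraph H"
  proof (intro ballI conjI)
    fix H assume "H \<in> ?S"
    then obtain m where m: "H = affine_space (m + 2)" by blast
    have H: "steiner_system H" using affine_space_steiner m by simp
    then show "uniform 4 H" by (simp add: steiner_system_def)
    have "(4::nat) ^ 1 < 4 ^ (m + 2)" by (rule power_strict_increasing) simp_all
    then have "4 < card (verts H)" using m card by simp
    with H show "soltes_hypergraph H" by (rule steiner_soltes)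
  qed
  show "pairwise (\<lambda>G H. \<not> isomorphic G H) ?S"
  proof (rule pairwiseI)
    fix G H assume "G \<in> ?S" "H \<in> ?S" "G \<noteq> H"
    then obtain m n where "G = affine_space (m + 2)" "H = affine_space (n + 2)" "m \<noteq> n" by blast
    then have "card (verts G) \<noteq> card (verts H)" by (simp add: card)
    then show "\<not> isomorphic G H" using isomorphic_card_verts by blast
  qed
qed

end
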